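(* For every continuous t-norm $\&$, the $[0,1]$-enriched category $(\mathbb{E}^1,P)$ is not Smyth complete.
   Context: A t-norm is a commutative, associative operation $\&:[0,1]\times[0,1]\to[0,1]$, monotone in each variable, with $x\,\&\,1=x$. Its residuated implication is $x\rightarrow y=\sup\{w\in[0,1] : x\,\&\,w\le y\}$. Fuzzy numbers: $\mathbb{E}^1$ is the set of all $u:\mathbb{R}\to[0,1]$ such that (1) $u(x_0)=1$ for some $x_0$; (2) $u(\lambda x+(1-\lambda)y)\ge\min\{u(x),u(y)\}$ for all $x,y\in\mathbb{R}$, $\lambda\in[0,1]$; (3) $u$ is upper semicontinuous; (4) $[u]_0=\overline{\{x: u(x)>0\}}$ is compact. Write $[u]_0=[u_0^-,u_0^+]$ and $[u]_1=\{x:u(x)=1\}=[u_1^-,u_1^+]$. The left part $u^\ell$ and right part $u^r$ are functions $\mathbb{R}\to[0,1]$: $u^\ell(x)=0$ for $x<u_0^-$, $u^\ell(x)=u(x)$ for $x\in[u_0^-,u_1^-]$, $u^\ell(x)=1$ for $x>u_1^-$; and $u^r(x)=1$ for $x<u_1^-$, $u^r(x)=u(x)$ for $x\in[u_1^-,u_0^+]$, $u^r(x)=0$ for $x>u_0^+$. Fuzzy order: $P(u,v)=\inf_{x\in\mathbb{R}}\left[(v^\ell(x)\rightarrow u^\ell(x))\wedge(u^r(x)\rightarrow v^r(x))\right]$ for $u,v\in\mathbb{E}^1$. A $[0,1]$-enriched category is a set $X$ with a map $X(\cdot,\cdot):X\times X\to[0,1]$ such that $X(x,x)=1$ and $X(y,z)\,\&\,X(x,y)\le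 X(x,z)$. The pair $(\mathbb{E}^1,P)$ is such a category. A net $\{x_i\}_{i\in D}$ in $X$ is forward Cauchy if $\sup_{i\in D}\inf_{k\ge j\ge i}X(x_j,x_k)=1$. An element $a\in X$ is a bilimit of $\{x_i\}_{i\in D}$ if for all $x\in X$: $\sup_{i\in D}\inf_{j\ge i}X(x,x_j)=X(x,a)$ and $\sup_{i\in D}\inf_{j\ge i}X(x_j,x)=X(a,x)$. $X$ is Smyth complete if every forward Cauchy net in $X$ has a bilimit (which is then unique up to isomorphism, where $x,y$ are isomorphic if $X(x,y)=1=X(y,x)$, and is the limit of the net in the open ball topology of the symmetrization, i.e. the topology with base the sets $\{y : \min\{X(x,y),X(y,x)\}>r\}$, $x\in X$, $r<1$). *)

theory Defs
  imports "HOL-Analysis.Analysis"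
begin

text \<open>
  The unit interval is the real set \<open>{0..1}\<close>; nothing is required of a t-norm outside it.
  All suprema and infima below are taken in the conditionally complete type \<^typ>\<open>real\<close>, over
  nonempty subsets of \<open>{0..1}\<close> (for nets: provided the index set is directed), so they agree
  with those of the complete lattice \<open>[0,1]\<close>.
\<close>

definition t_norm :: "(real \<Rightarrow> real \<Rightarrow> real) \<Rightarrow> bool" where
  "t_norm T \<longleftrightarrow>
     (\<forall>x\<in>{0..1}. \<forall>y\<in>{0..1}. T x y \<in> {0..1}) \<and>
     (\<forall>x\<in>{0..1}. \<forall>y\<in>{0..1}. T x y = T y x) \<and>
     (\<forall>x\<in>{0..1}. \<forall>y\<in>{0..1}. \<forall>z\<in>{0..1}. T (T x y) z = T x (T y z)) \<and>
     (\<forall>x\<in>{0..1}. \<forall>x'\<in>{0..1}. \<forall>y\<in>{0..1}.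
        x \<le> x' \<longrightarrow> T x y \<le> T x' y \<and> T y x \<le> T y x') \<and>
     (\<forall>x\<in>{0..1}. T x 1 = x)"

definition continuous_t_norm :: "(real \<Rightarrow> real \<Rightarrow> real) \<Rightarrow> bool" where
  "continuous_t_norm T \<longleftrightarrow>
     t_norm T \<and> continuous_on ({0..1} \<times> {0..1}) (\<lambda>(x, y). T x y)"

definition residuum :: "(real \<Rightarrow> real \<Rightarrow> real) \<Rightarrow> real \<Rightarrow> real \<Rightarrow> real" where
  "residuum T x y = Sup {w \<in> {0..1}. T x w \<le> y}"

definition upper_semicontinuous :: "(real \<Rightarrow> real) \<Rightarrow> bool" where
  "upper_semicontinuous u \<longleftrightarrow> (\<forall>x c. u x < c \<longrightarrow> (\<forall>\<^sub>F y in nhds x. u y < c))"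

definition support :: "(real \<Rightarrow> real) \<Rightarrow> real set" where
  "support u = closure {x. u x > 0}"

definition core :: "(real \<Rightarrow> real) \<Rightarrow> real set" where
  "core u = {x. u x = 1}"

definition fuzzy_numbers :: "(real \<Rightarrow> real) set" where
  "fuzzy_numbers = {u.
     (\<forall>x. u x \<in> {0..1}) \<and>
     (\<exists>x. u x = 1) \<and>
     (\<forall>x y. \<forall>t\<in>{0..1}. u (t * x + (1 - t) * y) \<ge> min (u x) (u y)) \<and>
     upper_semicontinuous u \<and>
     compact (support u)}"

lemma support_core_intervals:
  assumes "u \<in> fuzzy_numbers"
  shows "support u = {Inf (support u)..Sup (support u)}"
    and "core u = {Inf (core u)..Sup (core u)}"
    and "core u \<noteq> {}" and "core u \<subseteq> support u"
proof -
  have u01: "\<And>x. 0 \<le> u x \<and> u x \<le> 1"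
    and ne: "\<exists>x. u x = 1"
    and qc: "\<And>x y t. t \<in> {0..1} \<Longrightarrow> u (t * x + (1 - t) * y) \<ge> min (u x) (u y)"
    and usc: "upper_semicontinuous u" and comp: "compact (support u)"
    using assms unfolding fuzzy_numbers_def by auto
  show core_ne: "core u \<noteq> {}" using ne by (auto simp: core_def)
  have "core u \<subseteq> {x. u x > 0}" by (auto simp: core_def)
  then show sub: "core u \<subseteq> support u"
    unfolding support_def using closure_subset by blast
  have qc': "min (u x) (u y) \<le> u (a * x + b * y)"
    if "a \<ge> 0" "b \<ge> 0" "a + b = 1" for x y a b :: real
  proof -
    have "b = 1 - a" "a \<in> {0..1}" using that by auto
    then show ?thesis using qc by blast
  qed
  have conv_pos: "convex {x. u x > 0}"
    unfolding convex_def
  proof (clarsimp)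
    fix x y a b :: real
    assume "0 < u x" "0 < u y" "0 \<le> a" "0 \<le> b" "a + b = 1"
    then show "0 < u (a * x + b * y)"
      using qc'[of a b x y] by linarith
  qed
  have conv_core: "convex (core u)"
    unfolding convex_def core_def
  proof (clarsimp)
    fix x y a b :: real
    assume "u x = 1" "u y = 1" "0 \<le> a" "0 \<le> b" "a + b = 1"
    then show "u (a * x + b * y) = 1"
      using qc'[of a b x y] u01[of "a * x + b * y"] by simp
  qed
  have core_eq: "core u = - {x. u x < 1}"
    using u01 by (auto simp: core_def not_less intro: antisym)
  have "\<exists>S. open S \<and> x \<in> S \<and> S \<subseteq> {x. u x < 1}" if "u x < 1" for x
  proof -
    have "\<forall>\<^sub>F y in nhds x. u y < 1"
      using usc that by (simp add: upper_semicontinuous_def)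
    then show ?thesis unfolding eventually_nhds by (simp add: subset_eq)
  qed
  then have "open {x. u x < 1}"
    by (subst open_subopen) simp
  then have "closed (core u)" unfolding core_eq by (simp add: closed_Compl)
  then have comp_core: "compact (core u)"
    using compact_Int_closed[OF comp, of "core u"] sub by (simp add: Int_absorb1)
  have iv: "S = {Inf S..Sup S}" if c: "convex S" "compact S" "S \<noteq> {}" for S :: "real set"
  proof -
    have "connected S" using c convex_connected by blast
    then obtain a b where S: "S = {a..b}"
      using connected_compact_interval_1[of S] c(2) by (metis cbox_interval)
    then show ?thesis using c(3) by simp
  qed
  show "core u = {Inf (core u)..Sup (core u)}" using iv[OF conv_core comp_core core_ne] .
  show "support u = {Inf (support u)..Sup (support u)}"
    using comp core_ne sub convex_closure[OF conv_pos] by (intro iv) (auto simp: support_def)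
qed

definition left_part :: "(real \<Rightarrow> real) \<Rightarrow> real \<Rightarrow> real" where
  "left_part u x =
     (if x < Inf (support u) then 0 else if x \<le> Inf (core u) then u x else 1)"

definition right_part :: "(real \<Rightarrow> real) \<Rightarrow> real \<Rightarrow> real" where
  "right_part u x =
     (if x < Inf (core u) then 1 else if x \<le> Sup (support u) then u x else 0)"

definition fuzzy_order ::
  "(real \<Rightarrow> real \<Rightarrow> real) \<Rightarrow> (real \<Rightarrow> real) \<Rightarrow> (real \<Rightarrow> real) \<Rightarrow> real" where
  "fuzzy_order T u v =
     (INF x. min (residuum T (left_part v x) (left_part u x))
                 (residuum T (right_part u x) (right_part v x)))"

definition enriched_category ::
  "(real \<Rightarrow> real \<Rightarrow> real) \<Rightarrow> 'a set \<Rightarrow> ('a \<Rightarrow> 'a \<Rightarrow> real) \<Rightarrow> bool" where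
  "enriched_category T X h \<longleftrightarrow>
     (\<forall>x\<in>X. \<forall>y\<in>X. h x y \<in> {0..1}) \<and>
     (\<forall>x\<in>X. h x x = 1) \<and>
     (\<forall>x\<in>X. \<forall>y\<in>X. \<forall>z\<in>X. T (h y z) (h x y) \<le> h x z)"

definition directed_set :: "'i set \<Rightarrow> ('i \<Rightarrow> 'i \<Rightarrow> bool) \<Rightarrow> bool" where
  "directed_set D le \<longleftrightarrow>
     D \<noteq> {} \<and>
     (\<forall>i\<in>D. le i i) \<and>
     (\<forall>i\<in>D. \<forall>j\<in>D. \<forall>k\<in>D. le i j \<longrightarrow> le j k \<longrightarrow> le i k) \<and>
     (\<forall>i\<in>D. \<forall>j\<in>D. \<exists>k\<in>D. le i k \<and> le j k)"

definition forward_Cauchy ::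
  "('a \<Rightarrow> 'a \<Rightarrow> real) \<Rightarrow> 'i set \<Rightarrow> ('i \<Rightarrow> 'i \<Rightarrow> bool) \<Rightarrow> ('i \<Rightarrow> 'a) \<Rightarrow> bool" where
  "forward_Cauchy h D le s \<longleftrightarrow>
     (SUP i\<in>D. INF (j, k)\<in>{(j, k). j \<in> D \<and> k \<in> D \<and> le i j \<and> le j k}. h (s j) (s k)) = 1"

definition bilimit ::
  "'a set \<Rightarrow> ('a \<Rightarrow> 'a \<Rightarrow> real) \<Rightarrow> 'i set \<Rightarrow> ('i \<Rightarrow> 'i \<Rightarrow> bool) \<Rightarrow> ('i \<Rightarrow> 'a) \<Rightarrow> 'a \<Rightarrow> bool" where
  "bilimit X h D le s a \<longleftrightarrow>
     a \<in> X \<and>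
     (\<forall>x\<in>X. (SUP i\<in>D. INF j\<in>{j \<in> D. le i j}. h x (s j)) = h x a \<and>
             (SUP i\<in>D. INF j\<in>{j \<in> D. le i j}. h (s j) x) = h a x)"

text \<open>
  HOL cannot quantify over all index types inside a formula, so Smyth completeness takes the
  type of net indices as a parameter: \<open>smyth_complete TYPE('i) X h\<close> concerns the nets indexed
  by arbitrary directed preorders carried by subsets of \<open>'i\<close>. Failure of completeness for one
  \<open>'i\<close> yields a net without bilimit and hence refutes completeness for nets of all sizes.
  For a finite \<open>'i\<close> the notion is vacuous: a finite directed set has a greatest element, and
  the value of a forward Cauchy net there is a bilimit.
\<close>

definition smyth_complete :: "'i itself \<Rightarrow> 'a set \<Rightarrow> ('a \<Rightarrow> 'a \<Rightarrow> real) \<Rightarrow> bool" where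
  "smyth_complete I X h \<longleftrightarrow>
     (\<forall>(D :: 'i set) le s. directed_set D le \<and> s ` D \<subseteq> X \<and> forward_Cauchy h D le s \<longrightarrow>
        (\<exists>a. bilimit X h D le s a))"

lemma t_normD:
  assumes "t_norm T" "x \<in> {0..1}" "y \<in> {0..1}"
  shows "T x y \<in> {0..1}" and "T x y = T y x" and "T x 1 = x"
    and "z \<in> {0..1} \<Longrightarrow> T (T x y) z = T x (T y z)"
    and "z \<in> {0..1} \<Longrightarrow> x \<le> y \<Longrightarrow> T x z \<le> T y z"
    and "z \<in> {0..1} \<Longrightarrow> x \<le> y \<Longrightarrow> T z x \<le> T z y"
  using assms unfolding t_norm_def by blast+

lemma t_norm_zero_right:
  assumes "t_norm T" "x \<in> {0..1}"
  shows "T x 0 = 0"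
proof -
  have "T x 0 \<le> T 1 0" using t_normD(5)[OF assms(1), of x 1 0] assms(2) by simp
  also have "T 1 0 = T 0 1" using t_normD(2)[OF assms(1), of 1 0] by simp
  also have "T 0 1 = 0" using t_normD(3)[OF assms(1), of 0 0] by simp
  finally show ?thesis using t_normD(1)[OF assms, of 0] by simp
qed

lemma residuum_in_unit:
  assumes "t_norm T" "x \<in> {0..1}" "y \<in> {0..1}"
  shows "residuum T x y \<in> {0..1}"
proof -
  have "0 \<in> {w \<in> {0..1}. T x w \<le> y}" using assms t_norm_zero_right[OF assms(1,2)] by simp
  moreover have "bdd_above {w \<in> {0..1}. T x w \<le> y}" by (auto intro: bdd_aboveI[of _ 1])
  ultimately show ?thesis
    unfolding residuum_def by (auto intro: cSup_upper cSup_least)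
qed

lemma residuum_adjoint:
  assumes T: "continuous_t_norm T" and x: "x \<in> {0..1}" and y: "y \<in> {0..1}" and w: "w \<in> {0..1}"
  shows "w \<le> residuum T x y \<longleftrightarrow> T x w \<le> y"
proof -
  let ?S = "{w \<in> {0..1}. T x w \<le> y}"
  have t: "t_norm T" using T by (simp add: continuous_t_norm_def)
  have "0 \<in> ?S" using y t_norm_zero_right[OF t x] by simp
  then have ne: "?S \<noteq> {}" by blast
  have bdd: "bdd_above ?S" by (auto intro: bdd_aboveI[of _ 1])
  have c: "continuous_on ({0..1} \<times> {0..1}) (\<lambda>(x, y). T x y)"
    using T by (simp add: continuous_t_norm_def)
  have "continuous_on {0..1} (\<lambda>w. (\<lambda>(x, y). T x y) (x, w))"
  proof (rule continuous_on_compose2[OF c])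
    show "continuous_on {0..1} (\<lambda>w. (x, w))" by (intro continuous_intros)
    show "(\<lambda>w. (x, w)) ` {0..1} \<subseteq> {0..1} \<times> {0..1}" using x by blast
  qed
  then have "continuous_on {0..1} (T x)" by simp
  then have "closed ?S"
    using continuous_on_closed_Collect_le[of "{0..1}" "T x" "\<lambda>_. y"] by simp
  then have mem: "residuum T x y \<in> ?S"
    unfolding residuum_def by (rule closed_contains_Sup[OF ne bdd])
  show ?thesis
  proof
    assume "w \<le> residuum T x y"
    then have "T x w \<le> T x (residuum T x y)"
      using t_normD(6)[OF t w _ x] mem by simp
    then show "T x w \<le> y" using mem by auto
  next
    assume "T x w \<le> y"
    then show "w \<le> residuum T x y"
      unfolding residuum_def using w by (intro cSup_upper[OF _ bdd]) simp
  qed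
qed

lemma parts_in_unit:
  assumes "u \<in> fuzzy_numbers"
  shows "left_part u x \<in> {0..1}" and "right_part u x \<in> {0..1}"
  using assms by (auto simp: fuzzy_numbers_def left_part_def right_part_def)

theorem fuzzy_order_enriched_category:
  assumes T: "continuous_t_norm T"
  shows "enriched_category T fuzzy_numbers (fuzzy_order T)"
proof -
  have t: "t_norm T" using T by (simp add: continuous_t_norm_def)
  let ?f = "\<lambda>u v x. min (residuum T (left_part v x) (left_part u x))
                          (residuum T (right_part u x) (right_part v x))"
  have f01: "0 \<le> ?f u v x" "?f u v x \<le> 1"
    if "u \<in> fuzzy_numbers" "v \<in> fuzzy_numbers" for u v x
    using residuum_in_unit[OF t parts_in_unit(1)[OF that(2)] parts_in_unit(1)[OF that(1)], of x x]
      residuum_in_unit[OF t parts_in_unit(2)[OF that(1)] parts_in_unit(2)[OF that(2)], of x x]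
    unfolding atLeastAtMost_iff by linarith+
  have bdd: "bdd_below (range (?f u v))"
    if "u \<in> fuzzy_numbers" "v \<in> fuzzy_numbers" for u v
    by (rule bdd_belowI2[of _ 0]) (rule f01(1)[OF that])
  have lower: "fuzzy_order T u v \<le> ?f u v x"
    if "u \<in> fuzzy_numbers" "v \<in> fuzzy_numbers" for u v x
    unfolding fuzzy_order_def by (rule cINF_lower[OF bdd[OF that]]) simp
  have P01: "fuzzy_order T u v \<in> {0..1}"
    if "u \<in> fuzzy_numbers" "v \<in> fuzzy_numbers" for u v
  proof -
    have "0 \<le> fuzzy_order T u v"
      unfolding fuzzy_order_def by (rule cINF_greatest[OF UNIV_not_empty f01(1)[OF that]])
    moreover have "fuzzy_order T u v \<le> 1"
      using lower[OF that, of 0] f01(2)[OF that, of 0] by (rule order_trans)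
    ultimately show ?thesis by simp
  qed
  have refl: "residuum T p p = 1" if "p \<in> {0..1}" for p
  proof -
    have "T p 1 \<le> p" using t_normD(3)[OF t that that] by simp
    then have "1 \<le> residuum T p p" using residuum_adjoint[OF T that that, of 1] by simp
    then show ?thesis using residuum_in_unit[OF t that that] by simp
  qed
  have id: "fuzzy_order T u u = 1" if "u \<in> fuzzy_numbers" for u
    unfolding fuzzy_order_def
    using refl[OF parts_in_unit(1)[OF that]] refl[OF parts_in_unit(2)[OF that]] by simp
  have comp: "T a b \<le> residuum T p r"
    if "p \<in> {0..1}" "q \<in> {0..1}" "r \<in> {0..1}" "a \<in> {0..1}" "b \<in> {0..1}"
      "a \<le> residuum T p q" "b \<le> residuum T q r" for a b p q r
  proof -
    have 1: "T p a \<le> q" using residuum_adjoint[OF T that(1,2,4)] that(6) by simp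
    have 2: "T q b \<le> r" using residuum_adjoint[OF T that(2,3,5)] that(7) by simp
    have "T p a \<in> {0..1}" "T a b \<in> {0..1}"
      using t_normD(1)[OF t that(1,4)] t_normD(1)[OF t that(4,5)] .
    then have "T p (T a b) = T (T p a) b" "T (T p a) b \<le> T q b"
      using t_normD(4)[OF t that(1,4,5)] t_normD(5)[OF t \<open>T p a \<in> {0..1}\<close> that(2,5) 1] by simp_all
    then show ?thesis
      using 2 residuum_adjoint[OF T that(1,3) \<open>T a b \<in> {0..1}\<close>] by linarith
  qed
  have trans: "T (fuzzy_order T v w) (fuzzy_order T u v) \<le> fuzzy_order T u w"
    if u: "u \<in> fuzzy_numbers" and v: "v \<in> fuzzy_numbers" and w: "w \<in> fuzzy_numbers" for u v w
  proof -
    let ?a = "fuzzy_order T v w" and ?b = "fuzzy_order T u v"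
    note a = P01[OF v w] and b = P01[OF u v]
    have swap: "T ?a ?b = T ?b ?a" using t_normD(2)[OF t a b] .
    have "T ?a ?b \<le> ?f u w x" for x
    proof (rule min.boundedI)
      show "T ?a ?b \<le> residuum T (left_part w x) (left_part u x)"
        using lower[OF v w, of x] lower[OF u v, of x]
        by (intro comp[of _ "left_part v x"] parts_in_unit u v w a b) linarith+
      show "T ?a ?b \<le> residuum T (right_part u x) (right_part w x)"
        unfolding swap using lower[OF v w, of x] lower[OF u v, of x]
        by (intro comp[of _ "right_part v x"] parts_in_unit u v w a b) linarith+
    qed
    then show ?thesis
      unfolding fuzzy_order_def[of T u w] by (rule cINF_greatest[OF UNIV_not_empty])
  qed
  show ?thesis unfolding enriched_category_def using P01 id trans by blast
qed

end

theory Submission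
  imports Defs
begin

text \<open>
  Completeness fails because a fuzzy number must have compact support, while an increasing
  sequence of fuzzy numbers may have supports that exhaust a half-line. Cut the decreasing
  profile \<open>1/(1 + x)\<close> off to the interval \<open>[0,n]\<close>. The resulting fuzzy numbers \<open>u\<^sub>n\<close> all have
  the same left part, and their right parts increase with \<open>n\<close>, so \<open>P(u\<^sub>m, u\<^sub>n) = 1\<close> for
  \<open>m \<le> n\<close> and the sequence is forward Cauchy for a trivial reason.

  A bilimit \<open>a\<close> would, by its defining property tested against \<open>a\<close> itself, satisfy
  \<open>sup\<^sub>i inf\<^sub>j\<^sub>\<ge>\<^sub>i P(u\<^sub>j, a) = P(a, a) = 1\<close>. But take a point \<open>x > 0\<close> to the right of the support
  of \<open>a\<close>. For every \<open>j \<ge> x\<close> the right part of \<open>u\<^sub>j\<close> has at \<open>x\<close> the same value \<open>p = 1/(1 + x)\<close>,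
  while the right part of \<open>a\<close> vanishes there, so \<open>P(u\<^sub>j, a) \<le> p \<rightarrow> 0\<close>. This bound does not
  depend on \<open>j\<close>, and for a continuous t-norm \<open>p \<rightarrow> 0 = 1\<close> would force \<open>p = p & 1 \<le> 0\<close>.
\<close>

lemma residuum_eq_1_iff:
  assumes T: "continuous_t_norm T" and x: "x \<in> {0..1}" and y: "y \<in> {0..1}"
  shows "residuum T x y = 1 \<longleftrightarrow> x \<le> y"
proof -
  have t: "t_norm T" using T by (simp add: continuous_t_norm_def)
  have "1 \<le> residuum T x y \<longleftrightarrow> x \<le> y"
    using residuum_adjoint[OF T x y, of 1] t_normD(3)[OF t x x] by simp
  then show ?thesis using residuum_in_unit[OF t x y] by auto
qed

lemma fuzzy_order_eq_1:
  assumes T: "continuous_t_norm T"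
    and u: "u \<in> fuzzy_numbers" and v: "v \<in> fuzzy_numbers"
    and left: "\<And>x. left_part v x \<le> left_part u x"
    and right: "\<And>x. right_part u x \<le> right_part v x"
  shows "fuzzy_order T u v = 1"
proof -
  have "residuum T (left_part v x) (left_part u x) = 1" for x
    using residuum_eq_1_iff[OF T parts_in_unit(1)[OF v] parts_in_unit(1)[OF u]] left by blast
  moreover have "residuum T (right_part u x) (right_part v x) = 1" for x
    using residuum_eq_1_iff[OF T parts_in_unit(2)[OF u] parts_in_unit(2)[OF v]] right by blast
  ultimately show ?thesis by (simp add: fuzzy_order_def)
qed

lemma fuzzy_order_le_right_residuum:
  assumes T: "continuous_t_norm T"
    and u: "u \<in> fuzzy_numbers" and v: "v \<in> fuzzy_numbers"
  shows "fuzzy_order T u v \<le> residuum T (right_part u x) (right_part v x)"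
proof -
  have t: "t_norm T" using T by (simp add: continuous_t_norm_def)
  let ?f = "\<lambda>x. min (residuum T (left_part v x) (left_part u x))
                    (residuum T (right_part u x) (right_part v x))"
  have "0 \<le> ?f x" for x
    using residuum_in_unit[OF t parts_in_unit(1)[OF v] parts_in_unit(1)[OF u], of x x]
      residuum_in_unit[OF t parts_in_unit(2)[OF u] parts_in_unit(2)[OF v], of x x]
    by simp
  then have "bdd_below (range ?f)" by (rule bdd_belowI2)
  then have "fuzzy_order T u v \<le> ?f x"
    unfolding fuzzy_order_def by (rule cINF_lower) simp
  then show ?thesis by simp
qed

lemma forward_Cauchy_increasing:
  assumes "directed_set D le"
    and "\<And>j k. j \<in> D \<Longrightarrow> k \<in> D \<Longrightarrow> le j k \<Longrightarrow> h (s j) (s k) = 1"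
  shows "forward_Cauchy h D le s"
proof -
  have ne: "D \<noteq> {}" and refl: "\<And>i. i \<in> D \<Longrightarrow> le i i"
    using assms(1) by (auto simp: directed_set_def)
  have "(INF (j, k)\<in>{(j, k). j \<in> D \<and> k \<in> D \<and> le i j \<and> le j k}. h (s j) (s k)) = 1"
    if "i \<in> D" for i
  proof -
    let ?S = "{(j, k). j \<in> D \<and> k \<in> D \<and> le i j \<and> le j k}"
    have "?S \<noteq> {}" using that refl by blast
    moreover have "(INF (j, k)\<in>?S. h (s j) (s k)) = (INF _\<in>?S. 1)"
      by (rule INF_cong) (auto simp: assms(2))
    ultimately show ?thesis by simp
  qed
  then show ?thesis using ne by (simp add: forward_Cauchy_def cong: SUP_cong)
qed

text \<open>
  Testing a bilimit \<open>a\<close> against \<open>a\<close> itself shows that the net is eventually below \<open>a\<close> to every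
  degree less than \<open>1\<close>. This is the only consequence of being a bilimit that has to be refuted.
\<close>

lemma bilimit_imp_frequent_bound_ge_1:
  assumes X: "enriched_category T X h" and D: "directed_set D le" and s: "s ` D \<subseteq> X"
    and a: "bilimit X h D le s a"
    and r: "\<And>i. i \<in> D \<Longrightarrow> \<exists>j\<in>D. le i j \<and> h (s j) a \<le> r"
  shows "1 \<le> r"
proof -
  have aX: "a \<in> X" using a by (simp add: bilimit_def)
  have "(INF j\<in>{j \<in> D. le i j}. h (s j) a) \<le> r" if "i \<in> D" for i
  proof -
    obtain j where j: "j \<in> D" "le i j" "h (s j) a \<le> r" using r[OF \<open>i \<in> D\<close>] by blast
    have "0 \<le> h (s k) a" if "k \<in> D" for k
      using X s aX that by (auto simp: enriched_category_def)
    then have "bdd_below ((\<lambda>j. h (s j) a) ` {j \<in> D. le i j})" by (auto intro!: bdd_belowI2)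
    then have "(INF j\<in>{j \<in> D. le i j}. h (s j) a) \<le> h (s j) a"
      by (rule cINF_lower) (use j in simp)
    then show ?thesis using j by simp
  qed
  moreover have "D \<noteq> {}" using D by (simp add: directed_set_def)
  ultimately have "(SUP i\<in>D. INF j\<in>{j \<in> D. le i j}. h (s j) a) \<le> r"
    by (intro cSUP_least)
  moreover have "(SUP i\<in>D. INF j\<in>{j \<in> D. le i j}. h (s j) a) = h a a"
    using a aX by (simp add: bilimit_def)
  moreover have "h a a = 1" using X aX by (simp add: enriched_category_def)
  ultimately show ?thesis by simp
qed

definition truncated_tail :: "nat \<Rightarrow> real \<Rightarrow> real" where
  "truncated_tail n x = (if 0 \<le> x \<and> x \<le> real n then 1 / (1 + x) else 0)"

lemma support_truncated_tail: "support (truncated_tail n) = {0..real n}"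
proof -
  have "{x. truncated_tail n x > 0} = {0..real n}" by (auto simp: truncated_tail_def)
  then show ?thesis by (simp add: support_def)
qed

lemma core_truncated_tail: "core (truncated_tail n) = {0}"
  by (auto simp: core_def truncated_tail_def field_simps split: if_splits)

lemma truncated_tail_fuzzy_number: "truncated_tail n \<in> fuzzy_numbers"
proof -
  let ?u = "truncated_tail n"
  have unit: "0 \<le> ?u x" "?u x \<le> 1" for x
    by (auto simp: truncated_tail_def)
  have antimono: "?u y \<le> ?u z" if "0 \<le> z" "z \<le> y" for y z
    using that by (auto simp: truncated_tail_def frac_le)
  have qc: "min (?u x) (?u y) \<le> ?u (t * x + (1 - t) * y)" if t: "t \<in> {0..1}" for x y t
  proof (cases "0 \<le> x \<and> 0 \<le> y")
    case True
    then have "0 \<le> t * x + (1 - t) * y" using t by simp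
    moreover have "t * x + (1 - t) * y \<le> max x y" using t by (intro convex_bound_le) auto
    ultimately have "?u (max x y) \<le> ?u (t * x + (1 - t) * y)" by (rule antimono)
    then show ?thesis by (auto simp: max_def split: if_splits)
  next
    case False
    then have "?u x = 0 \<or> ?u y = 0" by (auto simp: truncated_tail_def)
    then show ?thesis using unit by (auto simp: min_le_iff_disj)
  qed
  have usc: "upper_semicontinuous ?u"
    unfolding upper_semicontinuous_def
  proof (intro allI impI)
    fix x c assume c: "?u x < c"
    have "0 < c" using c unit(1)[of x] by simp
    then have "{y. ?u y < c} = - {y \<in> {0..real n}. c \<le> 1 / (1 + y)}"
      by (auto simp: truncated_tail_def)
    moreover have "closed {y \<in> {0..real n}. c \<le> 1 / (1 + y)}"
      by (intro continuous_on_closed_Collect_le continuous_intros) auto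
    ultimately have "open {y. ?u y < c}" by (simp add: open_Compl)
    then show "\<forall>\<^sub>F y in nhds x. ?u y < c"
      using c eventually_nhds_in_open[of "{y. ?u y < c}" x] by simp
  qed
  have "?u 0 = 1" by (simp add: truncated_tail_def)
  moreover have "compact (support ?u)" by (simp add: support_truncated_tail)
  ultimately show ?thesis
    unfolding fuzzy_numbers_def using unit qc usc by auto
qed

lemma left_part_truncated_tail: "left_part (truncated_tail n) x = (if x < 0 then 0 else 1)"
  by (auto simp: left_part_def support_truncated_tail core_truncated_tail truncated_tail_def)

lemma right_part_truncated_tail:
  "right_part (truncated_tail n) x = (if x < 0 then 1 else truncated_tail n x)"
  by (auto simp: right_part_def support_truncated_tail core_truncated_tail truncated_tail_def)

lemma truncated_tail_increasing:
  assumes "continuous_t_norm T" "m \<le> n"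
  shows "fuzzy_order T (truncated_tail m) (truncated_tail n) = 1"
proof (rule fuzzy_order_eq_1[OF assms(1) truncated_tail_fuzzy_number truncated_tail_fuzzy_number])
  show "left_part (truncated_tail n) x \<le> left_part (truncated_tail m) x" for x
    by (simp add: left_part_truncated_tail)
  show "right_part (truncated_tail m) x \<le> right_part (truncated_tail n) x" for x
    using assms(2) by (auto simp: right_part_truncated_tail truncated_tail_def)
qed

text \<open>
  The sequence is not only without an upper bound among the fuzzy numbers: the degree to which
  its late members lie below a given \<open>a\<close> stays away from \<open>1\<close>. The bound is the residuum at a
  single point to the right of the support of \<open>a\<close>, where the sequence is eventually constant.
\<close>

lemma truncated_tail_eventually_not_below:
  assumes T: "continuous_t_norm T" and a: "a \<in> fuzzy_numbers"
  obtains r N where "r < 1"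
    and "\<And>n. N \<le> n \<Longrightarrow> fuzzy_order T (truncated_tail n) a \<le> r"
proof -
  have t: "t_norm T" using T by (simp add: continuous_t_norm_def)
  define x where "x = max 0 (Sup (support a)) + 1"
  have x: "0 < x" "Sup (support a) < x" by (auto simp: x_def)
  let ?p = "1 / (1 + x)"
  have p: "0 < ?p" "?p \<in> {0..1}" using x by auto
  have "Inf (core a) \<le> Sup (support a)"
  proof -
    obtain c where "c \<in> core a" using support_core_intervals(3)[OF a] by blast
    then have "Inf (core a) \<le> c" "c \<le> Sup (support a)"
      using support_core_intervals[OF a] by (metis atLeastAtMost_iff subsetD)+
    then show ?thesis by simp
  qed
  then have ra: "right_part a x = 0" using x by (simp add: right_part_def)
  have "residuum T ?p 0 \<noteq> 1" using residuum_eq_1_iff[OF T p(2), of 0] p(1) by simp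
  then have "residuum T ?p 0 < 1" using residuum_in_unit[OF t p(2), of 0] by simp
  moreover have "fuzzy_order T (truncated_tail n) a \<le> residuum T ?p 0"
    if "nat \<lceil>x\<rceil> \<le> n" for n
  proof -
    have "x \<le> real n" using that by linarith
    then have "right_part (truncated_tail n) x = ?p"
      using x by (simp add: right_part_truncated_tail truncated_tail_def)
    then show ?thesis
      using fuzzy_order_le_right_residuum[OF T truncated_tail_fuzzy_number a, of n x] ra by simp
  qed
  ultimately show ?thesis by (rule that)
qed

theorem theorem4p13:
  fixes T :: "real \<Rightarrow> real \<Rightarrow> real"
  assumes "continuous_t_norm T"
    and "infinite (UNIV :: 'i set)"
  shows "\<not> smyth_complete TYPE('i) fuzzy_numbers (fuzzy_order T)"
proof
  assume complete: "smyth_complete TYPE('i) fuzzy_numbers (fuzzy_order T)"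
  \<comment> \<open>A copy of the natural numbers inside \<^typ>\<open>'i\<close> turns the sequence into a net over \<^typ>\<open>'i\<close>.\<close>
  obtain f :: "nat \<Rightarrow> 'i" where f: "inj f"
    using infinite_countable_subset[OF assms(2)] by blast
  define D where "D = range f"
  define le where "le = (\<lambda>i j. inv f i \<le> inv f j)"
  define s where "s = (\<lambda>i. truncated_tail (inv f i))"
  have f_le: "le (f m) (f n) \<longleftrightarrow> m \<le> n" for m n using f by (simp add: le_def)
  have s_f: "s (f n) = truncated_tail n" for n using f by (simp add: s_def)
  have D: "directed_set D le"
    unfolding directed_set_def D_def by (auto simp: f_le) (meson linear order_refl)
  have sD: "s ` D \<subseteq> fuzzy_numbers" using truncated_tail_fuzzy_number by (auto simp: s_def)
  have "forward_Cauchy (fuzzy_order T) D le s"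
    using truncated_tail_increasing[OF assms(1)]
    by (intro forward_Cauchy_increasing[OF D]) (simp add: le_def s_def)
  then obtain a where a: "bilimit fuzzy_numbers (fuzzy_order T) D le s a"
    using complete D sD unfolding smyth_complete_def by blast
  then have "a \<in> fuzzy_numbers" by (simp add: bilimit_def)
  then obtain r N where "r < 1"
    and r: "\<And>n. N \<le> n \<Longrightarrow> fuzzy_order T (truncated_tail n) a \<le> r"
    using truncated_tail_eventually_not_below[OF assms(1)] by blast
  have "\<exists>j\<in>D. le i j \<and> fuzzy_order T (s j) a \<le> r" if "i \<in> D" for i
  proof -
    obtain m where "i = f m" using \<open>i \<in> D\<close> by (auto simp: D_def)
    then have "le i (f (max m N)) \<and> fuzzy_order T (s (f (max m N))) a \<le> r"
      using r by (simp add: f_le s_f)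
    then show ?thesis by (auto simp: D_def)
  qed
  then have "1 \<le> r"
    by (rule bilimit_imp_frequent_bound_ge_1
        [OF fuzzy_order_enriched_category[OF assms(1)] D sD a])
  then show False using \<open>r < 1\<close> by simp
qed

end
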